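(* Let $r,\nu\in(0,\infty)$ and $p\in(0,1)$, and let $W$ be a random variable with values in $\{0,1,2,\ldots\}$. Then $W$ has distribution $\mathrm{CMNB}(r,\nu,p)$ if and only if the equation $$\mathbb{E}\left[W^{\nu}g(W)-p(W+r)^{\nu}g(W+1)\right]=0$$ holds for every bounded function $g:\{0,1,2,\ldots\}\to\mathbb{R}$.
   Context: For $r,\nu\in(0,\infty)$ and $p\in(0,1)$, a random variable $X$ follows the COM-negative binomial distribution $\mathrm{CMNB}(r,\nu,p)$ if $$\mathrm{P}(X=k)=\left(\frac{\Gamma(r+k)}{k!\,\Gamma(r)}\right)^{\nu}p^k(1-p)^r\frac{1}{C(r,\nu,p)},\quad k=0,1,2,\ldots,\qquad C(r,\nu,p)=\sum_{i=0}^{\infty}\left(\frac{\Gamma(r+i)}{i!\,\Gamma(r)}\right)^{\nu}p^i(1-p)^r .$$ *)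

theory Defs
  imports "HOL-Probability.Probability" "HOL-Real_Asymp.Real_Asymp"
begin

definition cmnb_weight :: "real \<Rightarrow> real \<Rightarrow> real \<Rightarrow> nat \<Rightarrow> real" where
  "cmnb_weight r \<nu> p k =
     (Gamma (r + real k) / (fact k * Gamma r)) powr \<nu> * p ^ k * (1 - p) powr r"

definition cmnb_C :: "real \<Rightarrow> real \<Rightarrow> real \<Rightarrow> real" where
  "cmnb_C r \<nu> p = (\<Sum>i. cmnb_weight r \<nu> p i)"

definition cmnb_distributed ::
  "'a measure \<Rightarrow> ('a \<Rightarrow> nat) \<Rightarrow> real \<Rightarrow> real \<Rightarrow> real \<Rightarrow> bool" where
  "cmnb_distributed M X r \<nu> p \<longleftrightarrow>
     X \<in> measurable M (count_space UNIV) \<and>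
     (\<forall>k. measure M {\<omega> \<in> space M. X \<omega> = k} = cmnb_weight r \<nu> p k / cmnb_C r \<nu> p)"

lemma cmnb_weight_pos:
  assumes "r > 0" "0 < p" "p < 1"
  shows "cmnb_weight r \<nu> p k > 0"
proof -
  have "Gamma (r + real k) / (fact k * Gamma r) > 0"
    using assms by (intro divide_pos_pos mult_pos_pos Gamma_real_pos) auto
  hence "(Gamma (r + real k) / (fact k * Gamma r)) powr \<nu> > 0"
    by (simp only: powr_gt_zero)
  moreover have "(1 - p) powr r > 0"
    using assms by simp
  ultimately show ?thesis
    unfolding cmnb_weight_def using assms by (intro mult_pos_pos) auto
qed

lemma cmnb_weight_Suc:
  assumes "r > 0" "0 < p" "p < 1"
  shows "cmnb_weight r \<nu> p (Suc k) =
           p * ((r + real k) / real (Suc k)) powr \<nu> * cmnb_weight r \<nu> p k"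
proof -
  have "r + real k \<notin> \<int>\<^sub>\<le>\<^sub>0"
    using assms nonpos_Ints_nonpos[of "r + real k"] by auto
  hence "Gamma (r + real (Suc k)) = (r + real k) * Gamma (r + real k)"
    using Gamma_plus1[of "r + real k"] by (simp add: add_ac)
  hence "Gamma (r + real (Suc k)) / (fact (Suc k) * Gamma r) =
      ((r + real k) / real (Suc k)) * (Gamma (r + real k) / (fact k * Gamma r))"
    by simp
  thus ?thesis
    unfolding cmnb_weight_def using assms by (simp only: powr_mult) (simp add: mult_ac)
qed

text \<open>The series defining the normalising constant converges, so \<open>cmnb_C\<close> is a genuine sum.\<close>

lemma summable_cmnb_weight:
  assumes "r > 0" "0 < p" "p < 1"
  shows "summable (cmnb_weight r \<nu> p)"
proof -
  have "(\<lambda>k. (r + real k) / real (Suc k)) \<longlonglongrightarrow> 1"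
    by real_asymp
  hence "(\<lambda>k. p * ((r + real k) / real (Suc k)) powr \<nu>) \<longlonglongrightarrow> p * 1 powr \<nu>"
    by (intro tendsto_intros) auto
  moreover obtain c where c: "p < c" "c < 1"
    using dense assms by blast
  ultimately have "eventually (\<lambda>k. p * ((r + real k) / real (Suc k)) powr \<nu> < c) sequentially"
    by (intro order_tendstoD) auto
  then obtain N where N: "p * ((r + real k) / real (Suc k)) powr \<nu> < c" if "k \<ge> N" for k
    by (auto simp: eventually_sequentially)
  show ?thesis
  proof (rule summable_ratio_test[OF c(2)])
    fix k assume "N \<le> k"
    have pos: "cmnb_weight r \<nu> p j > 0" for j
      by (intro cmnb_weight_pos assms)
    have "cmnb_weight r \<nu> p (Suc k) \<le> c * cmnb_weight r \<nu> p k"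
      unfolding cmnb_weight_Suc[OF assms]
      using N[OF \<open>N \<le> k\<close>] pos[of k] by (intro mult_right_mono) auto
    thus "norm (cmnb_weight r \<nu> p (Suc k)) \<le> c * norm (cmnb_weight r \<nu> p k)"
      using pos[of k] pos[of "Suc k"] by (simp add: abs_of_pos)
  qed
qed

end

theory Submission
  imports Defs
begin

text \<open>
  The mass function \<open>q\<close> of \<open>W\<close> is proportional to \<open>cmnb_weight\<close> iff it satisfies the detailed balance
  relation \<open>(k + 1)\<^sup>\<nu> q (k + 1) = p (k + r)\<^sup>\<nu> q k\<close>. Testing the expectation identity against indicators
  of points gives this relation; conversely, under the relation the expectation is a telescoping
  series with value \<open>0\<^sup>\<nu> g 0 q 0 = 0\<close>.
\<close>

text \<open>A measure on a countable type is determined by its values on singletons, and both sides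
  give \<open>{k}\<close> the probability that \<open>X\<close> equals \<open>k\<close>.\<close>

lemma (in prob_space) distr_count_space_eq_density:
  fixes X :: "'a \<Rightarrow> 'b :: countable"
  assumes "X \<in> measurable M (count_space UNIV)"
  shows "distr M (count_space UNIV) X
           = density (count_space UNIV) (\<lambda>k. ennreal (prob {\<omega> \<in> space M. X \<omega> = k}))"
proof (rule measure_eqI_countable[of _ UNIV])
  fix k :: 'b
  show "emeasure (distr M (count_space UNIV) X) {k}
      = emeasure (density (count_space UNIV) (\<lambda>k. ennreal (prob {\<omega> \<in> space M. X \<omega> = k}))) {k}"
    using assms
    by (simp add: emeasure_distr emeasure_density emeasure_eq_measure vimage_def Int_def conj_commute)
qed auto

text \<open>Bridge from probability to series: passing to the law of \<open>X\<close> and then to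
  the counting measure turns integrability into absolute summability and the expectation into the
  sum of a series.\<close>

lemma (in prob_space)
  fixes X :: "'a \<Rightarrow> nat" and f :: "nat \<Rightarrow> real"
  assumes X: "X \<in> measurable M (count_space UNIV)"
  defines "q \<equiv> \<lambda>k. prob {\<omega> \<in> space M. X \<omega> = k}"
  shows integrable_nat_valued_iff: "integrable M (\<lambda>\<omega>. f (X \<omega>)) \<longleftrightarrow> summable (\<lambda>k. \<bar>q k * f k\<bar>)"
    and expectation_nat_valued:
      "integrable M (\<lambda>\<omega>. f (X \<omega>)) \<Longrightarrow> (\<lambda>k. q k * f k) sums expectation (\<lambda>\<omega>. f (X \<omega>))"
proof -
  have q: "0 \<le> q k" for k
    by (simp add: q_def)
  have distr: "distr M (count_space UNIV) X = density (count_space UNIV) (\<lambda>k. ennreal (q k))"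
    unfolding q_def by (rule distr_count_space_eq_density[OF X])
  have "integrable M (\<lambda>\<omega>. f (X \<omega>)) \<longleftrightarrow> integrable (distr M (count_space UNIV) X) f"
    using X by (simp add: integrable_distr_eq)
  also have "\<dots> \<longleftrightarrow> integrable (count_space UNIV) (\<lambda>k. q k * f k)"
    unfolding distr
    using q by (subst integrable_density) auto
  finally have iff: "integrable M (\<lambda>\<omega>. f (X \<omega>)) \<longleftrightarrow> integrable (count_space UNIV) (\<lambda>k. q k * f k)" .
  thus "integrable M (\<lambda>\<omega>. f (X \<omega>)) \<longleftrightarrow> summable (\<lambda>k. \<bar>q k * f k\<bar>)"
    by (simp add: integrable_count_space_nat_iff)
  have "expectation (\<lambda>\<omega>. f (X \<omega>)) = (\<integral>k. f k \<partial>distr M (count_space UNIV) X)"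
    using X by (simp add: integral_distr)
  also have "\<dots> = (\<integral>k. q k * f k \<partial>count_space UNIV)"
    unfolding distr
    using q by (subst integral_density) auto
  finally show "(\<lambda>k. q k * f k) sums expectation (\<lambda>\<omega>. f (X \<omega>))"
    if "integrable M (\<lambda>\<omega>. f (X \<omega>))"
    using that iff sums_integral_count_space_nat by metis
qed

lemma cmnb_weight_detailed_balance:
  assumes "r > 0" "0 < p" "p < 1"
  shows "real (Suc k) powr \<nu> * cmnb_weight r \<nu> p (Suc k)
           = p * (real k + r) powr \<nu> * cmnb_weight r \<nu> p k"
  using assms by (simp add: cmnb_weight_Suc powr_divide add_ac)

text \<open>The factor \<open>real k + r\<close> is absorbed by the Gamma function and shifts the
  parameter from \<open>r\<close> to \<open>r + 1\<close>. So each term is a constant multiple of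
  \<open>cmnb_weight (r + 1) \<nu> p k\<close>; the constant makes up for
  \<open>Gamma (r + 1) = r * Gamma r\<close> and for the extra power of
  \<open>1 - p\<close>.\<close>

lemma summable_powr_cmnb_weight:
  assumes "r > 0" "0 < p" "p < 1"
  shows "summable (\<lambda>k. (real k + r) powr \<nu> * cmnb_weight r \<nu> p k)"
proof -
  have "(real k + r) powr \<nu> * cmnb_weight r \<nu> p k
      = r powr \<nu> / (1 - p) * cmnb_weight (r + 1) \<nu> p k" for k
  proof -
    have "Gamma (r + 1) = r * Gamma r"
      using assms by (intro Gamma_plus1) (auto dest: nonpos_Ints_nonpos)
    moreover have "Gamma (r + real k + 1) = (r + real k) * Gamma (r + real k)"
      using assms by (intro Gamma_plus1) (auto dest: nonpos_Ints_nonpos)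
    ultimately have "r * (Gamma (r + 1 + real k) / (fact k * Gamma (r + 1)))
        = (real k + r) * (Gamma (r + real k) / (fact k * Gamma r))"
      using assms by (simp add: add_ac)
    hence "r powr \<nu> * (Gamma (r + 1 + real k) / (fact k * Gamma (r + 1))) powr \<nu>
        = (real k + r) powr \<nu> * (Gamma (r + real k) / (fact k * Gamma r)) powr \<nu>"
      by (metis powr_mult)
    moreover have "(1 - p) powr (r + 1) = (1 - p) powr r * (1 - p)"
      using assms by (simp add: powr_add)
    ultimately show ?thesis
      unfolding cmnb_weight_def using assms by simp
  qed
  moreover have "summable (\<lambda>k. r powr \<nu> / (1 - p) * cmnb_weight (r + 1) \<nu> p k)"
    using assms by (intro summable_mult summable_cmnb_weight) auto
  ultimately show ?thesis
    by simp
qed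

lemma cmnb_C_pos:
  assumes "r > 0" "0 < p" "p < 1"
  shows "cmnb_C r \<nu> p > 0"
  unfolding cmnb_C_def using assms by (intro suminf_pos summable_cmnb_weight cmnb_weight_pos)

text \<open>The relation is a first-order recurrence, so \<open>q\<close> is fixed up to the factor
  \<open>q 0\<close>; total mass 1 then fixes that factor.\<close>

lemma detailed_balance_imp_cmnb:
  assumes rp: "r > 0" "0 < p" "p < 1"
    and q: "q sums 1"
    and balance: "\<And>k. real (Suc k) powr \<nu> * q (Suc k) = p * (real k + r) powr \<nu> * q k"
  shows "q k = cmnb_weight r \<nu> p k / cmnb_C r \<nu> p"
proof -
  define w where "w = cmnb_weight r \<nu> p"
  have w_pos: "w k > 0" for k
    unfolding w_def using rp by (rule cmnb_weight_pos)
  have ratio: "q k = q 0 / w 0 * w k" for k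
  proof (induction k)
    case 0
    show ?case using w_pos[of 0] by simp
  next
    case (Suc k)
    have "real (Suc k) powr \<nu> * q (Suc k) = q 0 / w 0 * (p * (real k + r) powr \<nu> * w k)"
      unfolding balance by (subst Suc.IH) simp
    also have "\<dots> = real (Suc k) powr \<nu> * (q 0 / w 0 * w (Suc k))"
      unfolding w_def cmnb_weight_detailed_balance[OF rp, symmetric] by simp
    finally show ?case
      by (rule mult_left_cancel[THEN iffD1, rotated]) simp
  qed
  have "w sums cmnb_C r \<nu> p"
    unfolding w_def cmnb_C_def using rp by (intro summable_sums summable_cmnb_weight)
  hence "(\<lambda>k. q 0 / w 0 * w k) sums (q 0 / w 0 * cmnb_C r \<nu> p)"
    by (rule sums_mult)
  hence "q 0 / w 0 * cmnb_C r \<nu> p = 1"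
    using q ratio sums_unique2 by (metis (no_types, lifting) ext)
  hence "q 0 / w 0 = 1 / cmnb_C r \<nu> p"
    using cmnb_C_pos[OF rp, of \<nu>] by (metis eq_divide_eq less_irrefl)
  thus ?thesis
    using ratio[of k] by (simp add: w_def)
qed

theorem lemma3p3:
  fixes M :: "'a measure" and W :: "'a \<Rightarrow> nat" and r \<nu> p :: real
  assumes "prob_space M"
    and "W \<in> measurable M (count_space UNIV)"
    and "r > 0" and "\<nu> > 0" and "0 < p" and "p < 1"
  shows "cmnb_distributed M W r \<nu> p \<longleftrightarrow>
    (\<forall>g :: nat \<Rightarrow> real. bounded (range g) \<longrightarrow>
       integrable M (\<lambda>\<omega>. real (W \<omega>) powr \<nu> * g (W \<omega>)
                          - p * (real (W \<omega>) + r) powr \<nu> * g (W \<omega> + 1)) \<and>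
       prob_space.expectation M (\<lambda>\<omega>. real (W \<omega>) powr \<nu> * g (W \<omega>)
                          - p * (real (W \<omega>) + r) powr \<nu> * g (W \<omega> + 1)) = 0)"
proof -
  interpret prob_space M by fact
  note W = assms(2) and rp = \<open>r > 0\<close> \<open>0 < p\<close> \<open>p < 1\<close>
  define q where "q = (\<lambda>k. prob {\<omega> \<in> space M. W \<omega> = k})"
  define h where "h = (\<lambda>(g :: nat \<Rightarrow> real) k.
    real k powr \<nu> * g k - p * (real k + r) powr \<nu> * g (k + 1))"
  have integrable_iff: "integrable M (\<lambda>\<omega>. f (W \<omega>)) \<longleftrightarrow> summable (\<lambda>k. \<bar>q k * f k\<bar>)" for f :: "nat \<Rightarrow> real"
    unfolding q_def by (rule integrable_nat_valued_iff[OF W])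
  have q_sums: "(\<lambda>k. q k * f k) sums expectation (\<lambda>\<omega>. f (W \<omega>))"
    if "integrable M (\<lambda>\<omega>. f (W \<omega>))" for f :: "nat \<Rightarrow> real"
    using expectation_nat_valued[OF W that] unfolding q_def .
  have distributed_iff: "cmnb_distributed M W r \<nu> p \<longleftrightarrow> (\<forall>k. q k = cmnb_weight r \<nu> p k / cmnb_C r \<nu> p)"
    using W by (simp add: cmnb_distributed_def q_def)
  have "(\<forall>k. q k = cmnb_weight r \<nu> p k / cmnb_C r \<nu> p) \<longleftrightarrow>
    (\<forall>g. bounded (range g) \<longrightarrow>
       integrable M (\<lambda>\<omega>. h g (W \<omega>)) \<and> expectation (\<lambda>\<omega>. h g (W \<omega>)) = 0)" (is "?L \<longleftrightarrow> ?R")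
  proof
    assume L: ?L
    have balance: "real (Suc k) powr \<nu> * q (Suc k) = p * (real k + r) powr \<nu> * q k" for k
      using cmnb_weight_detailed_balance[OF rp, of k \<nu>] L by simp
    have q_nonneg: "q k \<ge> 0" for k
      by (simp add: q_def)
    \<comment> \<open>By \<open>balance\<close> these terms are
      \<open>real (Suc k) powr \<nu> * q (Suc k)\<close>, so this says that \<open>W\<close> has a
      finite moment of order \<nu>.\<close>
    have "summable (\<lambda>k. (real k + r) powr \<nu> * cmnb_weight r \<nu> p k * (p / cmnb_C r \<nu> p))"
      using rp by (intro summable_mult2 summable_powr_cmnb_weight)
    hence summable_shift: "summable (\<lambda>k. real (Suc k) powr \<nu> * q (Suc k))"
      unfolding balance using L by (simp add: mult_ac)
    show ?R
    proof (intro allI impI)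
      fix g :: "nat \<Rightarrow> real" assume "bounded (range g)"
      then obtain B where B: "\<bar>g k\<bar> \<le> B" for k
        by (auto simp: bounded_iff)
      \<comment> \<open>The sequence that telescopes: by \<open>balance\<close> the subtracted part
        of \<open>q k * h g k\<close> is exactly \<open>a (Suc k)\<close>.\<close>
      define a where "a = (\<lambda>k. real k powr \<nu> * q k * g k)"
      have a_shift: "\<bar>a (Suc k)\<bar> \<le> real (Suc k) powr \<nu> * q (Suc k) * B" for k
        unfolding a_def abs_mult using B[of "Suc k"] q_nonneg[of "Suc k"]
        by (intro mult_mono) auto
      have shift: "summable (\<lambda>k. \<bar>a (Suc k)\<bar>)"
        by (rule summable_comparison_test'[OF summable_mult2[OF summable_shift, of B]])
          (use a_shift in auto)
      hence "summable (\<lambda>k. \<bar>a k\<bar>)"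
        by (subst (asm) summable_Suc_iff)
      \<comment> \<open>Integrability asks for absolute convergence, which telescoping alone does
        not give; this series dominates \<open>\<bar>a k - a (Suc k)\<bar>\<close>.\<close>
      hence abs: "summable (\<lambda>k. \<bar>a k\<bar> + \<bar>a (Suc k)\<bar>)"
        using shift by (rule summable_add)
      have qh: "q k * h g k = a k - a (Suc k)" for k
        using arg_cong[OF balance[of k], of "\<lambda>x. x * g (Suc k)"]
        by (simp add: h_def a_def algebra_simps)
      have int: "integrable M (\<lambda>\<omega>. h g (W \<omega>))"
        unfolding integrable_iff qh
        by (rule summable_comparison_test'[OF abs]) auto
      have "a \<longlonglongrightarrow> 0"
        using summable_rabs_cancel[OF \<open>summable (\<lambda>k. \<bar>a k\<bar>)\<close>] by (rule summable_LIMSEQ_zero)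
      hence "(\<lambda>k. q k * h g k) sums (a 0 - 0)"
        unfolding qh by (rule telescope_sums')
      hence "expectation (\<lambda>\<omega>. h g (W \<omega>)) = a 0"
        using q_sums[OF int] by (simp add: sums_unique2)
      \<comment> \<open>The boundary term \<open>a 0\<close> vanishes because \<open>powr\<close> is
        0 at base 0.\<close>
      thus "integrable M (\<lambda>\<omega>. h g (W \<omega>)) \<and> expectation (\<lambda>\<omega>. h g (W \<omega>)) = 0"
        using int by (simp add: a_def)
    qed
  next
    assume R: ?R
    have "q sums 1"
      using q_sums[of "\<lambda>_. 1"] by (simp add: prob_space)
    moreover have "real (Suc k) powr \<nu> * q (Suc k) = p * (real k + r) powr \<nu> * q k" for k
    proof -
      \<comment> \<open>For this indicator \<open>h g\<close> lives on two points, with value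
        \<open>real (Suc k) powr \<nu>\<close> at \<open>Suc k\<close> and
        \<open>- p * (real k + r) powr \<nu>\<close> at \<open>k\<close>. The indicator of 0 would
        only give 0 = 0.\<close>
      define g :: "nat \<Rightarrow> real" where "g = (\<lambda>j. if j = Suc k then 1 else 0)"
      have "bounded (range g)"
        unfolding bounded_iff g_def by (intro exI[of _ 1]) auto
      hence int: "integrable M (\<lambda>\<omega>. h g (W \<omega>))" and "expectation (\<lambda>\<omega>. h g (W \<omega>)) = 0"
        using R by auto
      hence "(\<lambda>j. q j * h g j) sums 0"
        using q_sums[OF int] by simp
      moreover have "(\<lambda>j. q j * h g j) sums (\<Sum>j\<in>{k, Suc k}. q j * h g j)"
        by (rule sums_finite) (auto simp: h_def g_def)
      ultimately have "(\<Sum>j\<in>{k, Suc k}. q j * h g j) = 0"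
        using sums_unique2 by blast
      thus ?thesis
        by (simp add: h_def g_def mult_ac)
    qed
    ultimately show ?L
      using detailed_balance_imp_cmnb[OF rp] by blast
  qed
  thus ?thesis
    unfolding distributed_iff by (simp add: h_def)
qed

end
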